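(* Every PST-class contains every bipartite graph, and the intersection of any two PST-classes is again a PST-class. Moreover, each of the following families of graphs is a PST-class: (a) the family of $\ell$-colorable graphs, for every integer $\ell\ge 2$; (b) the family of $K_t$-free graphs, for every integer $t\ge 3$; (c) the family of graphs that contain no odd cycle of length shorter than $g$, for every positive integer $g$.
   Context: All graphs are finite, simple and undirected, and families of graphs are considered up to isomorphism. $N(v)$ denotes the set of neighbours of the vertex $v$. A family of graphs $\mathcal{B}$ is a PST-class if it satisfies the following four properties: (1) $\mathcal{B}$ contains a graph with at least one edge; (2) $\mathcal{B}$ is closed under taking subgraphs; (3) $\mathcal{B}$ is closed under taking the union of disjoint copies of graphs in $\mathcal{B}$ (i.e. disjoint unions of graphs in $\mathcal{B}$ are in $\mathcal{B}$); (4) $\mathcal{B}$ is closed under vertex cloning, i.e. under replacing a vertex $v$ with vertices $v_1,\ldots,v_m$ such that $N(v_i)=N(v)$ for all $1\le i\le m$ (so the $v_i$ are pairwise non-adjacent). A graph is $K_t$-free if it contains no complete subgraph on $t$ vertices. *)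

theory Defs
  imports "Graph_Theory.Kuratowski" "Graph_Theory.Digraph_Isomorphism"
begin

text \<open>
  A finite simple undirected graph is a \<^locale>\<open>pair_graph\<close>: finitely many vertices, no loops, and
  each edge \<open>uv\<close> represented by the two arcs \<open>(u, v)\<close> and \<open>(v, u)\<close>. Every finite graph has an
  isomorphic copy on natural numbers, so a family of graphs up to isomorphism is an
  isomorphism-closed set of graphs with vertices of type \<^typ>\<open>nat\<close>.
\<close>

definition graph_family :: "nat pair_pre_digraph set \<Rightarrow> bool" where
  "graph_family B \<longleftrightarrow>
     (\<forall>G\<in>B. pair_graph G) \<and>
     (\<forall>G\<in>B. \<forall>H. pair_graph H \<and> digraph_iso (with_proj G) (with_proj H) \<longrightarrow> H \<in> B)"

definition pair_union :: "'a pair_pre_digraph \<Rightarrow> 'a pair_pre_digraph \<Rightarrow> 'a pair_pre_digraph" where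
  "pair_union G H = \<lparr> pverts = pverts G \<union> pverts H, parcs = parcs G \<union> parcs H \<rparr>"

definition neighbours :: "'a pair_pre_digraph \<Rightarrow> 'a \<Rightarrow> 'a set" where
  "neighbours G v = {u. (v, u) \<in> parcs G}"

text \<open>
  The vertex \<open>v\<close> is replaced by the vertices in \<open>W\<close>, each with neighbourhood \<open>N(v)\<close>. This is meant
  for \<open>W\<close> finite, nonempty and disjoint from the remaining vertices; \<open>v\<close> itself may belong to \<open>W\<close>.
\<close>

definition clone_vertex :: "'a pair_pre_digraph \<Rightarrow> 'a \<Rightarrow> 'a set \<Rightarrow> 'a pair_pre_digraph" where
  "clone_vertex G v W =
     \<lparr> pverts = (pverts G - {v}) \<union> W,
       parcs = {(x, y) \<in> parcs G. x \<noteq> v \<and> y \<noteq> v}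
               \<union> W \<times> neighbours G v \<union> neighbours G v \<times> W \<rparr>"

definition pst_class :: "nat pair_pre_digraph set \<Rightarrow> bool" where
  "pst_class B \<longleftrightarrow>
     graph_family B \<and>
     (\<exists>G\<in>B. parcs G \<noteq> {}) \<and>
     (\<forall>G\<in>B. \<forall>H. pair_graph H \<and> subgraph (with_proj H) (with_proj G) \<longrightarrow> H \<in> B) \<and>
     (\<forall>G\<in>B. \<forall>H\<in>B. pverts G \<inter> pverts H = {} \<longrightarrow> pair_union G H \<in> B) \<and>
     (\<forall>G\<in>B. \<forall>v\<in>pverts G. \<forall>W. finite W \<and> W \<noteq> {} \<and> W \<inter> (pverts G - {v}) = {}
        \<longrightarrow> clone_vertex G v W \<in> B)"

definition bipartite :: "'a pair_pre_digraph \<Rightarrow> bool" where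
  "bipartite G \<longleftrightarrow>
     (\<exists>X Y. pverts G = X \<union> Y \<and> X \<inter> Y = {} \<and> parcs G \<subseteq> X \<times> Y \<union> Y \<times> X)"

definition colorable :: "nat \<Rightarrow> 'a pair_pre_digraph \<Rightarrow> bool" where
  "colorable l G \<longleftrightarrow>
     (\<exists>c :: 'a \<Rightarrow> nat. (\<forall>v\<in>pverts G. c v < l) \<and> (\<forall>(u, v)\<in>parcs G. c u \<noteq> c v))"

definition complete_free :: "nat \<Rightarrow> 'a pair_pre_digraph \<Rightarrow> bool" where
  "complete_free t G \<longleftrightarrow> \<not> (\<exists>H. subgraph H (with_proj G) \<and> K\<^bsub>t\<^esub> H)"

text \<open>
  In a symmetric digraph, \<^const>\<open>pre_digraph.cycle\<close> also admits the length-2 walk along an edge and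
  back. Its length is even, so the cycles of odd length are exactly those of the undirected graph.
\<close>

definition no_short_odd_cycle :: "nat \<Rightarrow> 'a pair_pre_digraph \<Rightarrow> bool" where
  "no_short_odd_cycle g G \<longleftrightarrow>
     \<not> (\<exists>p. pre_digraph.cycle (with_proj G) p \<and> odd (length p) \<and> length p < g)"

end

theory Submission
  imports Defs
begin

text \<open>
  The three families are treated uniformly through graph homomorphisms. Passing to an isomorphic
  copy, to a subgraph, or to a graph with a cloned vertex all yield a graph that maps
  homomorphically to the original one: for cloning, the map sends every clone back to the vertex
  it came from. Hence a property that is inherited backwards along homomorphisms, is preserved by
  disjoint unions and holds for a single edge defines a PST-class (\<open>pst_class_of_hom_monotone\<close>).
  Colourings pull back by composition. A homomorphism into a loopless graph is injective on every
  clique, so it maps cliques to cliques of the same size. It maps an odd cycle only to an odd closed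
  walk, which may revisit vertices; but an odd closed walk always contains an odd cycle that is not
  longer (\<open>odd_closed_walk_imp_odd_cycle\<close>), so short odd cycles may be replaced by short odd
  closed walks. Cliques and closed walks are connected, so in a disjoint union they lie in one part.

  A PST-class contains every bipartite graph because a graph with an edge contains the single
  edge as a subgraph, cloning both of its ends gives complete bipartite graphs with parts of any
  positive sizes, and every bipartite graph is a subgraph of one of those
  (\<open>pst_class_bipartite\<close>). In particular, any two PST-classes share the single edge, which is the
  only point in the intersection statement that is not immediate.
\<close>

section \<open>Pair graphs and their homomorphisms\<close>

lemma pair_graph_iff:
  "pair_graph G \<longleftrightarrow> finite (pverts G) \<and> parcs G \<subseteq> pverts G \<times> pverts G \<and>
     irrefl (parcs G) \<and> sym (parcs G)"
proof
  assume "pair_graph G"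
  then interpret pair_graph G .
  show "finite (pverts G) \<and> parcs G \<subseteq> pverts G \<times> pverts G \<and> irrefl (parcs G) \<and> sym (parcs G)"
    using arcs_symmetric wellformed' no_loops'
    by (fastforce simp: irrefl_def intro!: symI)
next
  assume R: "finite (pverts G) \<and> parcs G \<subseteq> pverts G \<times> pverts G \<and> irrefl (parcs G) \<and> sym (parcs G)"
  then have "finite (parcs G)" by (meson finite_SigmaI finite_subset)
  with R show "pair_graph G"
    by unfold_locales (auto simp: irrefl_def symmetric_def)
qed

lemma subgraph_with_proj_iff:
  assumes "pair_graph G" "pair_graph H"
  shows "subgraph (with_proj H) (with_proj G) \<longleftrightarrow> pverts H \<subseteq> pverts G \<and> parcs H \<subseteq> parcs G"
proof -
  interpret G: pair_graph G by fact
  interpret H: pair_graph H by fact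
  show ?thesis
    using G.wf_digraph H.wf_digraph by (auto simp: subgraph_def)
qed

lemma pair_graph_pair_union:
  "pair_graph G \<Longrightarrow> pair_graph H \<Longrightarrow> pair_graph (pair_union G H)"
  by (auto simp: pair_graph_iff pair_union_def irrefl_def sym_Un)

lemma pair_graph_clone_vertex:
  assumes "pair_graph G" "finite W" "W \<inter> (pverts G - {v}) = {}"
  shows "pair_graph (clone_vertex G v W)"
proof -
  have "neighbours G v \<subseteq> pverts G - {v}"
    using assms(1) by (auto simp: pair_graph_iff neighbours_def irrefl_def)
  then show ?thesis
    using assms unfolding pair_graph_iff clone_vertex_def
    by (auto simp: irrefl_def sym_def)
qed

definition graph_hom :: "('a \<Rightarrow> 'b) \<Rightarrow> 'a pair_pre_digraph \<Rightarrow> 'b pair_pre_digraph \<Rightarrow> bool" where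
  "graph_hom f G H \<longleftrightarrow>
     f ` pverts G \<subseteq> pverts H \<and> (\<forall>(u, v)\<in>parcs G. (f u, f v) \<in> parcs H)"

lemma graph_hom_vert: "graph_hom f G H \<Longrightarrow> u \<in> pverts G \<Longrightarrow> f u \<in> pverts H"
  and graph_hom_arc: "graph_hom f G H \<Longrightarrow> (u, v) \<in> parcs G \<Longrightarrow> (f u, f v) \<in> parcs H"
  by (auto simp: graph_hom_def)

text \<open>
  No vertex of \<open>W\<close> other than \<open>v\<close> is a vertex of \<open>G\<close>, so folding \<open>W\<close> onto \<open>v\<close> leaves the arcs
  away from \<open>v\<close> alone; an arc between \<open>W\<close> and \<open>N(v)\<close> goes to an arc at \<open>v\<close>.
\<close>

lemma graph_hom_clone_vertex:
  assumes "pair_graph G" "v \<in> pverts G" "W \<inter> (pverts G - {v}) = {}"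
  shows "graph_hom (\<lambda>x. if x \<in> W then v else x) (clone_vertex G v W) G"
proof -
  have "neighbours G v \<subseteq> pverts G - {v}" "\<And>u. u \<in> neighbours G v \<Longrightarrow> (u, v) \<in> parcs G"
    using assms(1) by (auto simp: pair_graph_iff neighbours_def irrefl_def sym_def)
  moreover have "\<And>u w. (u, w) \<in> parcs G \<Longrightarrow> u \<in> pverts G \<and> w \<in> pverts G"
    using assms(1) by (auto simp: pair_graph_iff)
  ultimately show ?thesis
    using assms(2,3) unfolding graph_hom_def clone_vertex_def
    by (auto simp: neighbours_def; blast)
qed

text \<open>
  The map goes from the copy back to the original, the direction in which the properties below
  are transported.
\<close>

lemma graph_hom_of_iso:
  assumes "digraph_iso (with_proj G) (with_proj H)"
  obtains f where "graph_hom f H G"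
proof -
  obtain h where h: "pre_digraph.digraph_isomorphism (with_proj G) h"
    and H: "with_proj H = app_iso h (with_proj G)"
    using assms by (auto simp: digraph_iso_def)
  let ?f = "the_inv_into (pverts G) (iso_verts h)"
  \<comment> \<open>Both graphs use the projections as end maps, so the arc map is determined by the vertex map.\<close>
  have verts: "pverts H = iso_verts h ` pverts G" and arcs: "parcs H = iso_arcs h ` parcs G"
    and ends: "iso_tail h = fst" "iso_head h = snd"
    using arg_cong[OF H, of verts] arg_cong[OF H, of arcs]
      arg_cong[OF H, of tail] arg_cong[OF H, of head] by simp_all
  have inj: "inj_on (iso_verts h) (pverts G)"
    and arc: "\<And>u v. (u, v) \<in> parcs G \<Longrightarrow> iso_arcs h (u, v) = (iso_verts h u, iso_verts h v)"
    and wf: "pair_wf_digraph G"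
    using h by (auto simp: pre_digraph.digraph_isomorphism_def ends wf_digraph_wp_iff prod_eq_iff)
  interpret pair_wf_digraph G by (rule wf)
  have "?f (iso_verts h u) = u" if "u \<in> pverts G" for u
    using the_inv_into_f_f[OF inj that] .
  then have "graph_hom ?f H G"
    unfolding graph_hom_def verts arcs by (auto simp: arc in_arcsD1 in_arcsD2)
  then show thesis ..
qed

section \<open>What every PST-class contains\<close>

definition single_edge :: "'a \<Rightarrow> 'a \<Rightarrow> 'a pair_pre_digraph" where
  "single_edge a b = \<lparr> pverts = {a, b}, parcs = {(a, b), (b, a)} \<rparr>"

lemma pair_graph_single_edge: "a \<noteq> b \<Longrightarrow> pair_graph (single_edge a b)"
  by (auto simp: pair_graph_iff single_edge_def irrefl_def sym_def)

lemma single_edge_iso: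
  assumes "a \<noteq> b" "c \<noteq> d"
  shows "digraph_iso (with_proj (single_edge a b)) (with_proj (single_edge c d))"
proof -
  let ?f = "\<lambda>x. if x = a then c else d"
  let ?h = "\<lparr> iso_verts = ?f, iso_arcs = map_prod ?f ?f, iso_head = snd, iso_tail = fst \<rparr>"
  interpret pair_graph "single_edge a b" using assms(1) by (rule pair_graph_single_edge)
  have "pre_digraph.digraph_isomorphism (with_proj (single_edge a b)) ?h"
    using assms wf_digraph
    by (auto simp: pre_digraph.digraph_isomorphism_def single_edge_def inj_on_def)
  moreover have "with_proj (single_edge c d) = app_iso ?h (with_proj (single_edge a b))"
    using assms by (auto simp: app_iso_def single_edge_def with_proj_def)
  ultimately show ?thesis unfolding digraph_iso_def by blast
qed

lemma
  assumes "pst_class B"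
  shows pst_class_pair_graph: "G \<in> B \<Longrightarrow> pair_graph G"
    and pst_class_iso: "G \<in> B \<Longrightarrow> pair_graph H \<Longrightarrow> digraph_iso (with_proj G) (with_proj H) \<Longrightarrow> H \<in> B"
    and pst_class_edge: "\<exists>G\<in>B. parcs G \<noteq> {}"
    and pst_class_subgraph:
      "G \<in> B \<Longrightarrow> pair_graph H \<Longrightarrow> subgraph (with_proj H) (with_proj G) \<Longrightarrow> H \<in> B"
    and pst_class_pair_union:
      "G \<in> B \<Longrightarrow> H \<in> B \<Longrightarrow> pverts G \<inter> pverts H = {} \<Longrightarrow> pair_union G H \<in> B"
    and pst_class_clone:
      "G \<in> B \<Longrightarrow> v \<in> pverts G \<Longrightarrow> finite W \<Longrightarrow> W \<noteq> {} \<Longrightarrow> W \<inter> (pverts G - {v}) = {} \<Longrightarrow>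
        clone_vertex G v W \<in> B"
proof -
  note family = assms[unfolded pst_class_def, THEN conjunct1, unfolded graph_family_def]
    and closure = assms[unfolded pst_class_def, THEN conjunct2]
  show "G \<in> B \<Longrightarrow> pair_graph G"
    using family[THEN conjunct1] by blast
  show "G \<in> B \<Longrightarrow> pair_graph H \<Longrightarrow> digraph_iso (with_proj G) (with_proj H) \<Longrightarrow> H \<in> B"
    using family[THEN conjunct2] by blast
  show "\<exists>G\<in>B. parcs G \<noteq> {}"
    using closure[THEN conjunct1] .
  show "G \<in> B \<Longrightarrow> pair_graph H \<Longrightarrow> subgraph (with_proj H) (with_proj G) \<Longrightarrow> H \<in> B"
    using closure[THEN conjunct2, THEN conjunct1] by blast
  show "G \<in> B \<Longrightarrow> H \<in> B \<Longrightarrow> pverts G \<inter> pverts H = {} \<Longrightarrow> pair_union G H \<in> B"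
    using closure[THEN conjunct2, THEN conjunct2, THEN conjunct1] by blast
  show "G \<in> B \<Longrightarrow> v \<in> pverts G \<Longrightarrow> finite W \<Longrightarrow> W \<noteq> {} \<Longrightarrow> W \<inter> (pverts G - {v}) = {} \<Longrightarrow>
      clone_vertex G v W \<in> B"
    using closure[THEN conjunct2, THEN conjunct2, THEN conjunct2] by blast
qed

text \<open>
  The edge of a graph in the class lies at uncontrolled vertices; closure under isomorphism moves
  it to any two prescribed vertices.
\<close>

lemma pst_class_single_edge:
  assumes B: "pst_class B" and "a \<noteq> b"
  shows "single_edge a b \<in> B"
proof -
  obtain G u v where G: "G \<in> B" "(u, v) \<in> parcs G"
    using pst_class_edge[OF B] by auto
  have pg: "pair_graph G" using pst_class_pair_graph[OF B G(1)] .
  then have uv: "u \<noteq> v" "u \<in> pverts G" "v \<in> pverts G" "(v, u) \<in> parcs G"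
    using G(2) by (auto simp: pair_graph_iff irrefl_def sym_def)
  have "single_edge u v \<in> B"
    using uv G(2) subgraph_with_proj_iff[OF pg pair_graph_single_edge[OF uv(1)]]
    by (intro pst_class_subgraph[OF B G(1) pair_graph_single_edge[OF uv(1)]])
      (simp add: single_edge_def)
  then show ?thesis
    using pst_class_iso[OF B _ pair_graph_single_edge[OF \<open>a \<noteq> b\<close>] single_edge_iso[OF uv(1) \<open>a \<noteq> b\<close>]]
    by blast
qed

text \<open>
  For parts \<open>X\<close> and \<open>Y\<close>, start from an edge between two new vertices \<open>n\<close> and \<open>m\<close>, and clone \<open>n\<close>
  to \<open>X \<union> {n}\<close> and then \<open>m\<close> to \<open>Y \<union> {m}\<close>. Keeping \<open>n\<close> and \<open>m\<close> makes the sets of clones nonempty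
  even if a part is empty; since \<open>X\<close> and \<open>Y\<close> are disjoint and \<open>n\<close> and \<open>m\<close> are new, the clones
  avoid the remaining vertices.
\<close>

lemma pst_class_bipartite:
  assumes B: "pst_class B" and G: "pair_graph G" "bipartite G"
  shows "G \<in> B"
proof -
  obtain X Y where XY: "pverts G = X \<union> Y" "X \<inter> Y = {}" "parcs G \<subseteq> X \<times> Y \<union> Y \<times> X"
    using G(2) by (auto simp: bipartite_def)
  have fin: "finite X" "finite Y" using G(1) XY(1) by (auto simp: pair_graph_iff)
  obtain n where n: "n \<notin> X \<union> Y"
    using fin by (meson ex_new_if_finite finite_UnI infinite_UNIV_nat)
  obtain m where m: "m \<notin> insert n (X \<union> Y)"
    using fin by (meson ex_new_if_finite finite_UnI finite_insert infinite_UNIV_nat)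
  let ?X = "insert n X" and ?Y = "insert m Y"
  define S where "S = clone_vertex (single_edge n m) n ?X"
  define K where "K = clone_vertex S m ?Y"
  have nm: "n \<noteq> m" using m by auto
  have S_simps: "pverts S = insert m ?X" "parcs S = ?X \<times> {m} \<union> {m} \<times> ?X"
    using nm m by (auto simp: S_def clone_vertex_def single_edge_def neighbours_def)
  have "S \<in> B"
    unfolding S_def using n m nm fin
    by (intro pst_class_clone[OF B pst_class_single_edge[OF B nm]]) (auto simp: single_edge_def)
  then have K: "K \<in> B"
    unfolding K_def using n m XY(2) fin
    by (intro pst_class_clone[OF B]) (auto simp: S_simps)
  have "pverts K = ?X \<union> ?Y"
    using n m by (auto simp: K_def clone_vertex_def S_simps)
  then have "pverts G \<subseteq> pverts K" using XY(1) by blast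
  moreover have "neighbours S m = ?X"
    using n m by (auto simp: neighbours_def S_simps)
  then have "?X \<times> ?Y \<union> ?Y \<times> ?X \<subseteq> parcs K"
    by (auto simp: K_def clone_vertex_def)
  then have "parcs G \<subseteq> parcs K" using XY(3) by blast
  ultimately show ?thesis
    using subgraph_with_proj_iff[OF pst_class_pair_graph[OF B K] G(1)] pst_class_subgraph[OF B K G(1)]
    by blast
qed

section \<open>Closure under intersection\<close>

text \<open>
  Two classes could a priori have their edges in different graphs; a common graph with an edge
  exists because both contain every single edge.
\<close>

lemma pst_class_Int:
  assumes B: "pst_class B" and C: "pst_class C"
  shows "pst_class (B \<inter> C)"
proof -
  have "single_edge 0 1 \<in> B \<inter> C"
    using pst_class_single_edge[OF B, of 0 1] pst_class_single_edge[OF C, of 0 1] by simp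
  then have edge: "\<exists>G\<in>B \<inter> C. parcs G \<noteq> {}"
    by (rule bexI[rotated]) (simp add: single_edge_def)
  show ?thesis
    unfolding pst_class_def graph_family_def
  proof (intro conjI ballI allI impI edge)
    fix G assume "G \<in> B \<inter> C"
    then show "pair_graph G" using pst_class_pair_graph[OF B] by blast
  next
    fix G H :: "nat pair_pre_digraph"
    assume "G \<in> B \<inter> C" "pair_graph H \<and> digraph_iso (with_proj G) (with_proj H)"
    then show "H \<in> B \<inter> C" using pst_class_iso[OF B, of G H] pst_class_iso[OF C, of G H] by blast
  next
    fix G H assume "G \<in> B \<inter> C" "pair_graph H \<and> subgraph (with_proj H) (with_proj G)"
    then show "H \<in> B \<inter> C"
      using pst_class_subgraph[OF B, of G H] pst_class_subgraph[OF C, of G H] by blast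
  next
    fix G H assume "G \<in> B \<inter> C" "H \<in> B \<inter> C" "pverts G \<inter> pverts H = {}"
    then show "pair_union G H \<in> B \<inter> C"
      using pst_class_pair_union[OF B, of G H] pst_class_pair_union[OF C, of G H] by blast
  next
    fix G v W
    assume "G \<in> B \<inter> C" "v \<in> pverts G" "finite W \<and> W \<noteq> {} \<and> W \<inter> (pverts G - {v}) = {}"
    then show "clone_vertex G v W \<in> B \<inter> C"
      using pst_class_clone[OF B, of G v W] pst_class_clone[OF C, of G v W] by blast
  qed
qed

section \<open>Properties inherited along homomorphisms\<close>

text \<open>
  Isomorphic copies, subgraphs and clonings all come with a homomorphism to the original graph, so
  one hypothesis covers three closure conditions. Disjoint union needs its own, since a disjoint
  union need not map to either part.
\<close>

lemma pst_class_of_hom_monotone: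
  fixes P :: "nat pair_pre_digraph \<Rightarrow> bool"
  assumes hom: "\<And>f G H. pair_graph G \<Longrightarrow> pair_graph H \<Longrightarrow> graph_hom f G H \<Longrightarrow> P H \<Longrightarrow> P G"
    and union: "\<And>G H. pair_graph G \<Longrightarrow> pair_graph H \<Longrightarrow> pverts G \<inter> pverts H = {} \<Longrightarrow>
      P G \<Longrightarrow> P H \<Longrightarrow> P (pair_union G H)"
    and edge: "P (single_edge 0 1)"
  shows "pst_class {G. pair_graph G \<and> P G}"
  unfolding pst_class_def graph_family_def
proof (intro conjI ballI allI impI; clarsimp)
  fix G H :: "nat pair_pre_digraph"
  assume "pair_graph G" "P G" "pair_graph H" "digraph_iso (with_proj G) (with_proj H)"
  then show "P H" using hom graph_hom_of_iso by metis
next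
  show "\<exists>G. pair_graph G \<and> P G \<and> parcs G \<noteq> {}"
    using edge pair_graph_single_edge[of 0 "1::nat"]
    by (intro exI[of _ "single_edge 0 1"]) (simp add: single_edge_def)
next
  fix G H assume G: "pair_graph G" "P G" "pair_graph H" "subgraph (with_proj H) (with_proj G)"
  then have "graph_hom id H G"
    using subgraph_with_proj_iff[of G H] by (auto simp: graph_hom_def)
  then show "P H" using hom G by blast
next
  fix G H assume "pair_graph G" "P G" "pair_graph H" "P H" "pverts G \<inter> pverts H = {}"
  then show "pair_graph (pair_union G H) \<and> P (pair_union G H)"
    using union pair_graph_pair_union by blast
next
  fix G v and W :: "nat set"
  assume G: "pair_graph G" "P G" "v \<in> pverts G" "finite W" "W \<inter> (pverts G - {v}) = {}"
  then have clone: "pair_graph (clone_vertex G v W)" by (intro pair_graph_clone_vertex)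
  with G show "pair_graph (clone_vertex G v W) \<and> P (clone_vertex G v W)"
    using hom[OF clone G(1) graph_hom_clone_vertex[OF G(1,3,5)]] by blast
qed

section \<open>Colorable graphs\<close>

lemma colorable_hom:
  assumes "graph_hom f G H" "colorable l H"
  shows "colorable l G"
proof -
  obtain c :: "_ \<Rightarrow> nat"
    where "\<And>v. v \<in> pverts H \<Longrightarrow> c v < l" "\<And>u v. (u, v) \<in> parcs H \<Longrightarrow> c u \<noteq> c v"
    using assms(2) unfolding colorable_def by blast
  then show ?thesis
    unfolding colorable_def
    using graph_hom_vert[OF assms(1)] graph_hom_arc[OF assms(1)]
    by (intro exI[of _ "\<lambda>v. c (f v)"]) blast
qed

lemma colorable_pair_union:
  assumes "pair_graph G" "pair_graph H" "pverts G \<inter> pverts H = {}" "colorable l G" "colorable l H"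
  shows "colorable l (pair_union G H)"
proof -
  obtain c :: "_ \<Rightarrow> nat"
    where c: "\<And>v. v \<in> pverts G \<Longrightarrow> c v < l" "\<And>u v. (u, v) \<in> parcs G \<Longrightarrow> c u \<noteq> c v"
    using assms(4) unfolding colorable_def by blast
  obtain d :: "_ \<Rightarrow> nat"
    where d: "\<And>v. v \<in> pverts H \<Longrightarrow> d v < l" "\<And>u v. (u, v) \<in> parcs H \<Longrightarrow> d u \<noteq> d v"
    using assms(5) unfolding colorable_def by blast
  define e where "e x = (if x \<in> pverts G then c x else d x)" for x
  have "e u \<noteq> e v" if "(u, v) \<in> parcs G" for u v
    using that c(2) assms(1) by (auto simp: e_def pair_graph_iff)
  moreover have "e u \<noteq> e v" if "(u, v) \<in> parcs H" for u v
  proof -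
    have "u \<notin> pverts G" "v \<notin> pverts G"
      using that assms(2,3) by (auto simp: pair_graph_iff)
    then show ?thesis using that d(2) by (simp add: e_def)
  qed
  moreover have "e v < l" if "v \<in> pverts G \<union> pverts H" for v
    using that c(1) d(1) by (auto simp: e_def)
  ultimately show ?thesis
    unfolding colorable_def pair_union_def by (intro exI[of _ e]) auto
qed

lemma colorable_single_edge:
  fixes a b :: 'a
  assumes "a \<noteq> b" "2 \<le> l"
  shows "colorable l (single_edge a b)"
  unfolding colorable_def
  using assms by (intro exI[of _ "\<lambda>x. if x = a then 0 else 1"]) (auto simp: single_edge_def)

section \<open>Complete-free graphs\<close>

definition clique :: "'a pair_pre_digraph \<Rightarrow> 'a set \<Rightarrow> bool" where
  "clique G S \<longleftrightarrow> S \<subseteq> pverts G \<and> (\<forall>u\<in>S. \<forall>v\<in>S. u \<noteq> v \<longrightarrow> (u, v) \<in> parcs G)"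

text \<open>
  Replacing complete subgraphs by their vertex sets allows images to be taken under homomorphisms.
\<close>

lemma complete_free_iff_clique:
  assumes "pair_graph G"
  shows "complete_free t G \<longleftrightarrow> (\<forall>S. clique G S \<longrightarrow> card S \<noteq> t)"
proof -
  interpret pair_graph G by fact
  have "\<exists>S. clique G S \<and> card S = t" if H: "subgraph H (with_proj G)" "K\<^bsub>t\<^esub> H" for H
  proof -
    have "tail H = fst" "head H = snd"
      using H(1) by (auto simp: subgraph_def compatible_def)
    then have "arcs_ends H = arcs H" by (simp add: arcs_ends_conv)
    then have "clique G (verts H)" "card (verts H) = t"
      using H by (auto simp: clique_def complete_digraph_def subgraph_def)
    then show ?thesis by blast
  qed
  moreover have "\<exists>H. subgraph H (with_proj G) \<and> K\<^bsub>t\<^esub> H" if S: "clique G S" "card S = t" for S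
  proof -
    define H where "H = \<lparr> pverts = S, parcs = {(u, v). (u, v) \<in> S \<times> S \<and> u \<noteq> v} \<rparr>"
    have "finite S" using S(1) finite_verts by (auto simp: clique_def intro: finite_subset)
    then have K: "K\<^bsub>t\<^esub> (with_proj H)"
      using S(2) by (simp add: complete_digraph_pair_def H_def)
    then have "subgraph (with_proj H) (with_proj G)"
      using S(1) subgraph_with_proj_iff[OF assms pair_graphI_complete[OF K]]
      by (auto simp: H_def clique_def)
    with K show ?thesis by blast
  qed
  ultimately show ?thesis unfolding complete_free_def by blast
qed

text \<open>
  Two vertices of a clique with the same image would be adjacent, and their image would carry a
  loop.
\<close>

lemma clique_hom:
  assumes "pair_graph H" "graph_hom f G H" "clique G S"
  shows "clique H (f ` S)" "inj_on f S"
proof -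
  show "inj_on f S"
  proof (rule inj_onI, rule ccontr)
    fix u v assume "u \<in> S" "v \<in> S" "f u = f v" "u \<noteq> v"
    then have "(f u, f u) \<in> parcs H"
      using assms(2,3) by (metis clique_def graph_hom_arc)
    then show False using assms(1) by (auto simp: pair_graph_iff irrefl_def)
  qed
  show "clique H (f ` S)"
    using assms(2,3) unfolding clique_def graph_hom_def by fast
qed

lemma complete_free_hom:
  assumes "pair_graph G" "pair_graph H" "graph_hom f G H" "complete_free t H"
  shows "complete_free t G"
  using assms clique_hom[OF assms(2,3)] by (metis complete_free_iff_clique card_image)

text \<open>A vertex in each part would give an arc between the two parts.\<close>

lemma clique_pair_union:
  assumes "pair_graph G" "pair_graph H" "pverts G \<inter> pverts H = {}" "clique (pair_union G H) S"
  shows "clique G S \<or> clique H S"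
proof -
  have arcs: "u \<in> pverts G" "v \<in> pverts G" if "(u, v) \<in> parcs G" for u v
    using that assms(1) by (auto simp: pair_graph_iff)
  have arcs': "u \<in> pverts H" "v \<in> pverts H" if "(u, v) \<in> parcs H" for u v
    using that assms(2) by (auto simp: pair_graph_iff)
  have verts: "S \<subseteq> pverts G \<union> pverts H"
    using assms(4) by (simp add: clique_def pair_union_def)
  have adj: "(u, v) \<in> parcs G \<or> (u, v) \<in> parcs H" if "u \<in> S" "v \<in> S" "u \<noteq> v" for u v
    using that assms(4) by (simp add: clique_def pair_union_def)
  have "S \<subseteq> pverts G \<or> S \<subseteq> pverts H"
  proof (rule ccontr)
    assume "\<not> ?thesis"
    then obtain u v where uv: "u \<in> S" "v \<in> S" "u \<notin> pverts G" "v \<notin> pverts H" by blast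
    then have "u \<noteq> v" using verts by blast
    with uv adj arcs arcs' show False by blast
  qed
  then show ?thesis
  proof
    assume S: "S \<subseteq> pverts G"
    have "(u, v) \<in> parcs G" if "u \<in> S" "v \<in> S" "u \<noteq> v" for u v
      using adj[OF that] arcs'[of u v] S that(1) assms(3) by blast
    with S show ?thesis by (simp add: clique_def)
  next
    assume S: "S \<subseteq> pverts H"
    have "(u, v) \<in> parcs H" if "u \<in> S" "v \<in> S" "u \<noteq> v" for u v
      using adj[OF that] arcs[of u v] S that(1) assms(3) by blast
    with S show ?thesis by (simp add: clique_def)
  qed
qed

lemma complete_free_pair_union:
  assumes "pair_graph G" "pair_graph H" "pverts G \<inter> pverts H = {}"
    "complete_free t G" "complete_free t H"
  shows "complete_free t (pair_union G H)"
  using assms(4,5) clique_pair_union[OF assms(1-3)]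
  unfolding complete_free_iff_clique[OF assms(1)] complete_free_iff_clique[OF assms(2)]
    complete_free_iff_clique[OF pair_graph_pair_union[OF assms(1,2)]]
  by blast

lemma complete_free_single_edge:
  assumes "a \<noteq> b" "3 \<le> t"
  shows "complete_free t (single_edge a b)"
proof -
  have "card S < t" if "clique (single_edge a b) S" for S
  proof -
    have "card S \<le> card {a, b}"
      using that by (intro card_mono) (auto simp: clique_def single_edge_def)
    also have "\<dots> < t" using assms by simp
    finally show ?thesis .
  qed
  then show ?thesis
    using complete_free_iff_clique[OF pair_graph_single_edge[OF assms(1)]] by blast
qed

section \<open>Graphs without short odd cycles\<close>

definition closed_walk :: "'a pair_pre_digraph \<Rightarrow> ('a \<times> 'a) list \<Rightarrow> bool" where
  "closed_walk G p \<longleftrightarrow> (\<exists>u. pre_digraph.awalk (with_proj G) u p u)"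

text \<open>
  A closed walk that repeats a vertex splits at that vertex into two shorter closed walks. Their
  lengths add up to an odd number, so one of them is odd, and induction on the length applies.
\<close>

lemma (in wf_digraph) odd_closed_walk_imp_odd_cycle:
  assumes "awalk u p u" "odd (length p)"
  shows "\<exists>q. cycle q \<and> odd (length q) \<and> length q \<le> length p"
  using assms
proof (induction "length p" arbitrary: u p rule: less_induct)
  case less
  obtain e p' where p: "p = e # p'" using less.prems(2) by (cases p) auto
  show ?case
  proof (cases "distinct (tl (awalk_verts u p))")
    case True
    then have "cycle p" using less.prems p by (auto simp: cycle_def)
    then show ?thesis using less.prems by blast
  next
    case False
    \<comment> \<open>The start vertex occurs at both ends of the walk, so the repetition that matters is one in
      the walk without its first arc.\<close>
    have e: "awalk u [e] (head G e)" and p': "awalk (head G e) p' u"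
      using less.prems(1) p by (auto simp: awalk_Cons_iff awalk_Nil_iff)
    have "\<not> distinct (awalk_verts (head G e) p')" using False p by simp
    then obtain q r s w where qrs: "p' = q @ r @ s"
      "awalk (head G e) q w" "awalk w r w" "awalk w s u" "r \<noteq> []"
      using awalk_not_distinct_decomp[OF p'] by auto
    show ?thesis
    proof (cases "odd (length r)")
      case True
      then obtain c where "cycle c" "odd (length c)" "length c \<le> length r"
        using less.hyps[of r w] qrs p by auto
      then show ?thesis using qrs p by (intro exI[of _ c]) auto
    next
      case False
      have "awalk u (e # q @ s) u"
        using e qrs(2,4) by (auto simp: awalk_Cons_iff)
      moreover have "odd (length (e # q @ s))" "length (e # q @ s) < length p"
        using False less.prems(2) qrs p by auto
      ultimately obtain c where "cycle c" "odd (length c)" "length c \<le> length (e # q @ s)"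
        using less.hyps by blast
      then show ?thesis using \<open>length (e # q @ s) < length p\<close> by (intro exI[of _ c]) auto
    qed
  qed
qed

text \<open>
  Unlike cycles, closed walks are preserved by homomorphisms, together with their length.
\<close>

lemma no_short_odd_cycle_iff_closed_walk:
  assumes "pair_graph G"
  shows "no_short_odd_cycle g G \<longleftrightarrow> (\<forall>p. closed_walk G p \<longrightarrow> odd (length p) \<longrightarrow> g \<le> length p)"
proof -
  interpret pair_graph G by fact
  show ?thesis
  proof
    assume no_cycle: "no_short_odd_cycle g G"
    show "\<forall>p. closed_walk G p \<longrightarrow> odd (length p) \<longrightarrow> g \<le> length p"
    proof (intro allI impI)
      fix p assume "closed_walk G p" "odd (length p)"
      then obtain q where "cycle q" "odd (length q)" "length q \<le> length p"
        using odd_closed_walk_imp_odd_cycle unfolding closed_walk_def by blast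
      with no_cycle show "g \<le> length p"
        unfolding no_short_odd_cycle_def by fastforce
    qed
  next
    assume "\<forall>p. closed_walk G p \<longrightarrow> odd (length p) \<longrightarrow> g \<le> length p"
    then show "no_short_odd_cycle g G"
      unfolding no_short_odd_cycle_def closed_walk_def cycle_def by fastforce
  qed
qed

lemma awalk_hom:
  assumes "graph_hom f G H" "pre_digraph.awalk (with_proj G) u p v"
  shows "pre_digraph.awalk (with_proj H) (f u) (map (map_prod f f) p) (f v)"
proof -
  have "pcas u p v \<Longrightarrow> pcas (f u) (map (map_prod f f) p) (f v)"
    by (induction p arbitrary: u) auto
  then show ?thesis
    using assms by (auto simp: pre_digraph.awalk_def cas_with_proj_eq graph_hom_def)
qed

lemma no_short_odd_cycle_hom:
  assumes "pair_graph G" "pair_graph H" "graph_hom f G H" "no_short_odd_cycle g H"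
  shows "no_short_odd_cycle g G"
  using assms awalk_hom[OF assms(3)]
  unfolding no_short_odd_cycle_iff_closed_walk[OF assms(1)]
    no_short_odd_cycle_iff_closed_walk[OF assms(2)] closed_walk_def
  by (metis length_map)

text \<open>
  No arc leaves a part of a disjoint union, so a walk stays in the part where it starts.
\<close>

lemma awalk_pair_unionD:
  assumes "pair_graph G" "pair_graph H" "pverts G \<inter> pverts H = {}"
    and "pre_digraph.awalk (with_proj (pair_union G H)) u p v" "u \<in> pverts G"
  shows "pre_digraph.awalk (with_proj G) u p v"
proof -
  have arcs: "parcs G \<subseteq> pverts G \<times> pverts G" "parcs H \<subseteq> pverts H \<times> pverts H"
    using assms(1,2) by (auto simp: pair_graph_iff)
  have "pcas u p v \<Longrightarrow> set p \<subseteq> parcs G \<union> parcs H \<Longrightarrow> u \<in> pverts G \<Longrightarrow> set p \<subseteq> parcs G"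
  proof (induction p arbitrary: u)
    case (Cons e p)
    then have "fst e \<in> pverts G" "e \<in> parcs G \<union> parcs H" by simp_all
    then have "e \<in> parcs G" using arcs(2) assms(3) by (cases e) auto
    moreover from this have "snd e \<in> pverts G" using arcs by auto
    ultimately show ?case using Cons by auto
  qed simp
  then show ?thesis
    using assms(4,5) by (auto simp: pre_digraph.awalk_def cas_with_proj_eq pair_union_def)
qed

lemma pair_union_commute: "pair_union G H = pair_union H G"
  by (simp add: pair_union_def Un_commute)

lemma closed_walk_pair_union:
  assumes "pair_graph G" "pair_graph H" "pverts G \<inter> pverts H = {}" "closed_walk (pair_union G H) p"
  shows "closed_walk G p \<or> closed_walk H p"
proof -
  obtain u where u: "pre_digraph.awalk (with_proj (pair_union G H)) u p u"
    using assms(4) by (auto simp: closed_walk_def)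
  then have "u \<in> pverts G \<or> u \<in> pverts H"
    by (auto simp: pre_digraph.awalk_def pair_union_def)
  then show ?thesis
    using awalk_pair_unionD[of G H u p u] awalk_pair_unionD[of H G u p u] u assms
    by (auto simp: closed_walk_def pair_union_commute[of H G] Int_commute)
qed

lemma no_short_odd_cycle_pair_union:
  assumes "pair_graph G" "pair_graph H" "pverts G \<inter> pverts H = {}"
    "no_short_odd_cycle g G" "no_short_odd_cycle g H"
  shows "no_short_odd_cycle g (pair_union G H)"
  using assms(4,5) closed_walk_pair_union[OF assms(1-3)]
  unfolding no_short_odd_cycle_iff_closed_walk[OF assms(1)]
    no_short_odd_cycle_iff_closed_walk[OF assms(2)]
    no_short_odd_cycle_iff_closed_walk[OF pair_graph_pair_union[OF assms(1,2)]]
  by blast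

lemma no_short_odd_cycle_single_edge:
  assumes "a \<noteq> b"
  shows "no_short_odd_cycle g (single_edge a b)"
proof -
  \<comment> \<open>Every arc changes sides, so a closed walk has even length.\<close>
  define side :: "'a \<Rightarrow> nat" where "side x = (if x = a then 0 else 1)" for x
  have "even (length p + side u + side v)" if "pcas u p v" "set p \<subseteq> {(a, b), (b, a)}" for u p v
    using that
  proof (induction p arbitrary: u)
    case (Cons e p)
    then have "even (length p + side (snd e) + side v)" by simp
    moreover have "odd (side u + side (snd e))"
      using Cons.prems assms by (auto simp: side_def)
    ultimately show ?case by auto
  qed simp
  then have "even (length p)" if "pcas u p u" "set p \<subseteq> {(a, b), (b, a)}" for u p
    using that by fastforce
  then show ?thesis
    by (auto simp: no_short_odd_cycle_def pre_digraph.cycle_def pre_digraph.awalk_def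
        cas_with_proj_eq single_edge_def)
qed

section \<open>Basic facts about PST-classes\<close>

theorem theorem5:
  shows "(\<forall>B. pst_class B \<longrightarrow> (\<forall>G. pair_graph G \<and> bipartite G \<longrightarrow> G \<in> B)) \<and>
    (\<forall>B C. pst_class B \<and> pst_class C \<longrightarrow> pst_class (B \<inter> C)) \<and>
    (\<forall>l\<ge>2. pst_class {G. pair_graph G \<and> colorable l G}) \<and>
    (\<forall>t\<ge>3. pst_class {G. pair_graph G \<and> complete_free t G}) \<and>
    (\<forall>g>0. pst_class {G. pair_graph G \<and> no_short_odd_cycle g G})"
proof (intro conjI allI impI)
  fix l :: nat assume "2 \<le> l"
  then show "pst_class {G. pair_graph G \<and> colorable l G}"
    by (intro pst_class_of_hom_monotone colorable_single_edge)
      (rule colorable_hom colorable_pair_union, assumption+ | simp)+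
next
  fix t :: nat assume "3 \<le> t"
  then show "pst_class {G. pair_graph G \<and> complete_free t G}"
    by (intro pst_class_of_hom_monotone complete_free_single_edge)
      (rule complete_free_hom complete_free_pair_union, assumption+ | simp)+
next
  fix g :: nat
  show "pst_class {G. pair_graph G \<and> no_short_odd_cycle g G}"
    by (intro pst_class_of_hom_monotone no_short_odd_cycle_single_edge)
      (rule no_short_odd_cycle_hom no_short_odd_cycle_pair_union, assumption+ | simp)+
qed (auto intro: pst_class_bipartite pst_class_Int)

end
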